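(* Let $(X,\le,c)$ be a finite strongly involution poset. Define $h_+:\mathcal{W}_+(X,\mathbf{2})\to\mathcal{B}_{w_+}(X)$ by $h_+(A)=\langle W\cap A^{-1}(P)\mid W\cap A^{-1}(N)\rangle$ where $W=\mathrm{Core}_{w_+}(A)$, and $h_-:\mathcal{W}_-(X,\mathbf{2})\to\mathcal{B}_{w_-}(X)$ by $h_-(A)=\langle W\cap A^{-1}(P)\mid W\cap A^{-1}(N)\rangle$ where $W=\mathrm{Core}_{w_-}(A)$. Then these maps are well defined (take values in the indicated sets) and $h_+$ and $h_-$ are bijective.
   Context: A strongly involution poset is a poset $(X,\le)$ with $c:X\to X$, $x\mapsto x^c$, such that $(x^c)^c=x$, $x\le y\Rightarrow y^c\le x^c$, and $x^c\ne x$ for all $x$ (when $|X|\ge2$). For $Z\subseteq X$: $Z^c=\{z^c:z\in Z\}$, $\uparrow Z=\{x:\exists z\in Z,\ z\le x\}$, $\downarrow Z=\{x:\exists z\in Z,\ x\le z\}$, $\mathrm{Min}(Z),\mathrm{Max}(Z)$ the minimal/maximal elements. $\mathbf{2}$ is the chain $N<P$. $\mathcal{W}_+(X,\mathbf{2})$ (resp. $\mathcal{W}_-(X,\mathbf{2})$) is the set of maps $A:X\to\mathbf{2}$ such that $A^{-1}(P)$ is an up-set, $A^{-1}(N)$ is a down-set, and $A^{-1}(N)^c\subseteq A^{-1}(P)$ (resp. $A^{-1}(P)^c\subseteq A^{-1}(N)$). For such $A$, $N(A)=\mathrm{Min}(A^{-1}(P))\cup\mathrm{Max}(A^{-1}(N))$,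 $\mathrm{Core}_{w_+}(A)=N(A)\setminus[\mathrm{Max}(A^{-1}(N))]^c$ and $\mathrm{Core}_{w_-}(A)=N(A)\setminus[\mathrm{Min}(A^{-1}(P))]^c$. A $w_+$-basis for $X$ is an ordered pair $\langle Y_+\mid Y_-\rangle$ of disjoint antichains of $X$ with (B1+) $(\downarrow Y_+)\cap Y_-^c=\emptyset$, (B2+) $(\uparrow Y_+\cup\uparrow Y_-^c)\cap\downarrow Y_-=\emptyset$, (B3+) $X=(\uparrow Y_+\cup\uparrow Y_-^c)\cup\downarrow Y_-$. A $w_-$-basis is an ordered pair $\langle Y_+\mid Y_-\rangle$ of disjoint antichains with (B1-) $(\uparrow Y_-)\cap Y_+^c=\emptyset$, (B2-) $(\downarrow Y_-\cup\downarrow Y_+^c)\cap\uparrow Y_+=\emptyset$, (B3-) $X=(\downarrow Y_-\cup\downarrow Y_+^c)\cup\uparrow Y_+$. Two bases are equal iff both components are equal. $\mathcal{B}_{w_+}(X)$, $\mathcal{B}_{w_-}(X)$ denote the sets of $w_+$-bases and $w_-$-bases. *)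

theory Defs
  imports Main "HOL-Library.FuncSet"
begin

text \<open>
  A poset is given by its carrier \<open>X\<close> and its order relation \<open>r\<close>, with
  \<open>(x, y) \<in> r\<close> for $x \le y$; the library predicate \<open>partial_order_on X r\<close>
  includes \<open>r \<subseteq> X \<times> X\<close>. The map \<open>c\<close> is relevant only on \<open>X\<close>, and
  $Z^c$ is written \<open>c ` Z\<close>.
\<close>

locale strong_involution_poset =
  fixes X :: "'a set" and r :: "'a rel" and c :: "'a \<Rightarrow> 'a"
  assumes poset: "partial_order_on X r"
    and c_closed: "c \<in> X \<rightarrow> X"
    and c_involution: "\<And>x. x \<in> X \<Longrightarrow> c (c x) = x"
    and c_antitone: "\<And>x y. (x, y) \<in> r \<Longrightarrow> (c y, c x) \<in> r"
    \<comment> \<open>the premise says that \<open>X\<close> has at least two elements\<close>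
    and c_no_fixpoint: "(\<exists>a\<in>X. \<exists>b\<in>X. a \<noteq> b) \<Longrightarrow> \<forall>x\<in>X. c x \<noteq> x"

definition up_closure :: "'a set \<Rightarrow> 'a rel \<Rightarrow> 'a set \<Rightarrow> 'a set" where
  "up_closure X r Z = {x \<in> X. \<exists>z\<in>Z. (z, x) \<in> r}"

definition down_closure :: "'a set \<Rightarrow> 'a rel \<Rightarrow> 'a set \<Rightarrow> 'a set" where
  "down_closure X r Z = {x \<in> X. \<exists>z\<in>Z. (x, z) \<in> r}"

definition up_set :: "'a set \<Rightarrow> 'a rel \<Rightarrow> 'a set \<Rightarrow> bool" where
  "up_set X r Z \<longleftrightarrow> Z \<subseteq> X \<and> (\<forall>z\<in>Z. \<forall>x\<in>X. (z, x) \<in> r \<longrightarrow> x \<in> Z)"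

definition down_set :: "'a set \<Rightarrow> 'a rel \<Rightarrow> 'a set \<Rightarrow> bool" where
  "down_set X r Z \<longleftrightarrow> Z \<subseteq> X \<and> (\<forall>z\<in>Z. \<forall>x\<in>X. (x, z) \<in> r \<longrightarrow> x \<in> Z)"

definition min_elems :: "'a rel \<Rightarrow> 'a set \<Rightarrow> 'a set" where
  "min_elems r Z = {z \<in> Z. \<forall>y\<in>Z. (y, z) \<in> r \<longrightarrow> y = z}"

definition max_elems :: "'a rel \<Rightarrow> 'a set \<Rightarrow> 'a set" where
  "max_elems r Z = {z \<in> Z. \<forall>y\<in>Z. (z, y) \<in> r \<longrightarrow> y = z}"

definition antichain :: "'a set \<Rightarrow> 'a rel \<Rightarrow> 'a set \<Rightarrow> bool" where
  "antichain X r Y \<longleftrightarrow> Y \<subseteq> X \<and> (\<forall>x\<in>Y. \<forall>y\<in>Y. (x, y) \<in> r \<longrightarrow> x = y)"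

text \<open>The chain $\mathbf{2}$, where \<open>Neg\<close> is $N$ and \<open>Pos\<close> is $P$.\<close>

datatype two = Neg | Pos

instantiation two :: linorder
begin

definition less_two :: "two \<Rightarrow> two \<Rightarrow> bool" where
  "a < b \<longleftrightarrow> a = Neg \<and> b = Pos"

definition less_eq_two :: "two \<Rightarrow> two \<Rightarrow> bool" where
  "a \<le> b \<longleftrightarrow> a = Neg \<or> b = Pos"

instance
proof
  fix a b d :: two
  show "(a < b) = (a \<le> b \<and> \<not> b \<le> a)"
    by (cases a; cases b) (auto simp: less_two_def less_eq_two_def)
  show "a \<le> a"
    by (cases a) (auto simp: less_eq_two_def)
  show "a \<le> b \<Longrightarrow> b \<le> d \<Longrightarrow> a \<le> d"
    by (auto simp: less_eq_two_def)
  show "a \<le> b \<Longrightarrow> b \<le> a \<Longrightarrow> a = b"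
    by (auto simp: less_eq_two_def)
  show "a \<le> b \<or> b \<le> a"
    by (cases a) (auto simp: less_eq_two_def intro: two.exhaust)
qed

end

definition fiber :: "'a set \<Rightarrow> ('a \<Rightarrow> two) \<Rightarrow> two \<Rightarrow> 'a set" where
  "fiber X A v = {x \<in> X. A x = v}"

text \<open>
  Maps $X \to \mathbf{2}$ are elements of \<open>X \<rightarrow>\<^sub>E UNIV\<close>, that is, functions fixed
  to be \<open>undefined\<close> outside \<open>X\<close>, so that two of them are equal exactly when they agree
  on \<open>X\<close>.
\<close>

definition W_plus :: "'a set \<Rightarrow> 'a rel \<Rightarrow> ('a \<Rightarrow> 'a) \<Rightarrow> ('a \<Rightarrow> two) set" where
  "W_plus X r c = {A \<in> X \<rightarrow>\<^sub>E UNIV.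
     up_set X r (fiber X A Pos) \<and> down_set X r (fiber X A Neg) \<and>
     c ` fiber X A Neg \<subseteq> fiber X A Pos}"

definition W_minus :: "'a set \<Rightarrow> 'a rel \<Rightarrow> ('a \<Rightarrow> 'a) \<Rightarrow> ('a \<Rightarrow> two) set" where
  "W_minus X r c = {A \<in> X \<rightarrow>\<^sub>E UNIV.
     up_set X r (fiber X A Pos) \<and> down_set X r (fiber X A Neg) \<and>
     c ` fiber X A Pos \<subseteq> fiber X A Neg}"

definition N_set :: "'a set \<Rightarrow> 'a rel \<Rightarrow> ('a \<Rightarrow> two) \<Rightarrow> 'a set" where
  "N_set X r A = min_elems r (fiber X A Pos) \<union> max_elems r (fiber X A Neg)"

definition core_plus :: "'a set \<Rightarrow> 'a rel \<Rightarrow> ('a \<Rightarrow> 'a) \<Rightarrow> ('a \<Rightarrow> two) \<Rightarrow> 'a set" where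
  "core_plus X r c A = N_set X r A - c ` max_elems r (fiber X A Neg)"

definition core_minus :: "'a set \<Rightarrow> 'a rel \<Rightarrow> ('a \<Rightarrow> 'a) \<Rightarrow> ('a \<Rightarrow> two) \<Rightarrow> 'a set" where
  "core_minus X r c A = N_set X r A - c ` min_elems r (fiber X A Pos)"

text \<open>A basis $\langle Y_+ \mid Y_-\rangle$ is the pair \<open>(Yp, Ym)\<close>.\<close>

definition bases_plus :: "'a set \<Rightarrow> 'a rel \<Rightarrow> ('a \<Rightarrow> 'a) \<Rightarrow> ('a set \<times> 'a set) set" where
  "bases_plus X r c = {(Yp, Ym).
     antichain X r Yp \<and> antichain X r Ym \<and> Yp \<inter> Ym = {} \<and>
     down_closure X r Yp \<inter> c ` Ym = {} \<and>
     (up_closure X r Yp \<union> up_closure X r (c ` Ym)) \<inter> down_closure X r Ym = {} \<and>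
     X = (up_closure X r Yp \<union> up_closure X r (c ` Ym)) \<union> down_closure X r Ym}"

definition bases_minus :: "'a set \<Rightarrow> 'a rel \<Rightarrow> ('a \<Rightarrow> 'a) \<Rightarrow> ('a set \<times> 'a set) set" where
  "bases_minus X r c = {(Yp, Ym).
     antichain X r Yp \<and> antichain X r Ym \<and> Yp \<inter> Ym = {} \<and>
     up_closure X r Ym \<inter> c ` Yp = {} \<and>
     (down_closure X r Ym \<union> down_closure X r (c ` Yp)) \<inter> up_closure X r Yp = {} \<and>
     X = (down_closure X r Ym \<union> down_closure X r (c ` Yp)) \<union> up_closure X r Yp}"

definition h_plus :: "'a set \<Rightarrow> 'a rel \<Rightarrow> ('a \<Rightarrow> 'a) \<Rightarrow> ('a \<Rightarrow> two) \<Rightarrow> 'a set \<times> 'a set" where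
  "h_plus X r c A =
     (core_plus X r c A \<inter> fiber X A Pos, core_plus X r c A \<inter> fiber X A Neg)"

definition h_minus :: "'a set \<Rightarrow> 'a rel \<Rightarrow> ('a \<Rightarrow> 'a) \<Rightarrow> ('a \<Rightarrow> two) \<Rightarrow> 'a set \<times> 'a set" where
  "h_minus X r c A =
     (core_minus X r c A \<inter> fiber X A Pos, core_minus X r c A \<inter> fiber X A Neg)"

end

theory Submission
  imports Defs
begin

text \<open>
  In \<open>h_plus\<close> the second component is just \<open>Max N\<close>, because $N^c \subseteq P$; in a
  finite poset it generates \<open>N\<close> as a down-set, so it determines the map. Conversely, a basis
  \<open>(Yp, Ym)\<close> comes from the map with \<open>N\<close> the down-closure of \<open>Ym\<close>: there
  \<open>P\<close> is generated by \<open>Yp\<close> and $Y_-^c$, and (B1+) says that no element of $Y_-^c$ lies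
  below \<open>Yp\<close>, so \<open>Yp\<close> consists of the minimal elements of \<open>P\<close> outside $Y_-^c$.
  The statement for \<open>h_minus\<close> is the one for \<open>h_plus\<close> in the order dual.
\<close>

section \<open>Order duality for extremal elements, closures and antichains\<close>

lemma min_elems_converse: "min_elems (r\<inverse>) Z = max_elems r Z"
  by (simp add: min_elems_def max_elems_def)

lemma max_elems_converse: "max_elems (r\<inverse>) Z = min_elems r Z"
  by (simp add: min_elems_def max_elems_def)

lemma up_closure_converse: "up_closure X (r\<inverse>) Z = down_closure X r Z"
  by (simp add: up_closure_def down_closure_def)

lemma down_closure_converse: "down_closure X (r\<inverse>) Z = up_closure X r Z"
  by (simp add: up_closure_def down_closure_def)

lemma up_set_converse: "up_set X (r\<inverse>) Z = down_set X r Z"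
  by (simp add: up_set_def down_set_def)

lemma down_set_converse: "down_set X (r\<inverse>) Z = up_set X r Z"
  by (simp add: up_set_def down_set_def)

lemma antichain_converse: "antichain X (r\<inverse>) Y = antichain X r Y"
  by (auto simp: antichain_def)

section \<open>Extremal elements in finite subsets of a poset\<close>

lemma ex_max_elem_above:
  assumes "partial_order_on X r" "finite Z" "Z \<subseteq> X" "x \<in> Z"
  shows "\<exists>m\<in>max_elems r Z. (x, m) \<in> r"
  using assms(2-4)
proof (induction "card {y \<in> Z. (x, y) \<in> r}" arbitrary: x rule: less_induct)
  case less
  have refl: "(z, z) \<in> r" if "z \<in> X" for z
    using assms(1) that by (auto simp: partial_order_on_def preorder_on_def refl_on_def)
  have trans: "trans r" and antisym: "antisym r"
    using assms(1) by (auto simp: partial_order_on_def preorder_on_def)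
  show ?case
  proof (cases "x \<in> max_elems r Z")
    case True
    then show ?thesis using refl less.prems by blast
  next
    case False
    then obtain y where y: "y \<in> Z" "(x, y) \<in> r" "y \<noteq> x"
      using less.prems by (auto simp: max_elems_def)
    \<comment> \<open>Passing from \<open>x\<close> to a strictly larger \<open>y\<close> loses at
      least \<open>x\<close> itself, by antisymmetry, so the induction measure drops.\<close>
    have "{z \<in> Z. (y, z) \<in> r} \<subset> {z \<in> Z. (x, z) \<in> r}"
    proof
      show "{z \<in> Z. (y, z) \<in> r} \<subseteq> {z \<in> Z. (x, z) \<in> r}"
        using trans y(2) by (auto dest: transD)
      have "(y, x) \<notin> r" using antisym y by (auto dest: antisymD)
      then show "{z \<in> Z. (y, z) \<in> r} \<noteq> {z \<in> Z. (x, z) \<in> r}"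
        using refl less.prems by blast
    qed
    then have "card {z \<in> Z. (y, z) \<in> r} < card {z \<in> Z. (x, z) \<in> r}"
      using less.prems(1) by (intro psubset_card_mono) auto
    from less.hyps[OF this less.prems(1,2) y(1)]
    obtain m where "m \<in> max_elems r Z" "(y, m) \<in> r" by blast
    then show ?thesis using trans y(2) by (auto dest: transD)
  qed
qed

lemma ex_min_elem_below:
  assumes "partial_order_on X r" "finite Z" "Z \<subseteq> X" "x \<in> Z"
  shows "\<exists>m\<in>min_elems r Z. (m, x) \<in> r"
  using ex_max_elem_above[of X "r\<inverse>" Z x] assms
  by (simp add: max_elems_converse partial_order_on_converse)

lemma fiber_Neg_eq: "fiber X A Neg = X - fiber X A Pos"
  by (auto simp: fiber_def intro: two.exhaust)

lemma fiber_subset: "fiber X A v \<subseteq> X"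
  by (auto simp: fiber_def)

section \<open>Maps and bases for \<open>h_plus\<close>\<close>

context strong_involution_poset
begin

lemma refl: "x \<in> X \<Longrightarrow> (x, x) \<in> r"
  using poset by (auto simp: partial_order_on_def preorder_on_def refl_on_def)

lemma trans: "(x, y) \<in> r \<Longrightarrow> (y, z) \<in> r \<Longrightarrow> (x, z) \<in> r"
  using poset by (auto simp: partial_order_on_def preorder_on_def dest: transD)

lemma subset_up_closure: "Z \<subseteq> X \<Longrightarrow> Z \<subseteq> up_closure X r Z"
  using refl by (fastforce simp: up_closure_def)

lemma subset_down_closure: "Z \<subseteq> X \<Longrightarrow> Z \<subseteq> down_closure X r Z"
  using refl by (fastforce simp: down_closure_def)

lemma dual: "strong_involution_poset X (r\<inverse>) c"
proof unfold_locales
  show "partial_order_on X (r\<inverse>)"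
    using poset by (simp add: partial_order_on_converse)
qed (use c_closed c_involution c_antitone c_no_fixpoint in blast)+

text \<open>The elements removed in the core are images of the \<open>Neg\<close> fiber and hence
  lie in the \<open>Pos\<close> fiber, so the removal affects only the first component.\<close>

lemma h_plus_eq:
  assumes "A \<in> W_plus X r c"
  shows "h_plus X r c A =
    (min_elems r (fiber X A Pos) - c ` max_elems r (fiber X A Neg), max_elems r (fiber X A Neg))"
proof -
  have "c ` fiber X A Neg \<subseteq> fiber X A Pos"
    using assms by (simp add: W_plus_def)
  then show ?thesis
    by (auto simp: h_plus_def core_plus_def N_set_def min_elems_def max_elems_def fiber_def)
qed

text \<open>Finiteness puts every element of \<open>Z\<close> below a maximal one. With the next
  lemma this makes down-sets and antichains correspond.\<close>

lemma down_closure_max_elems: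
  assumes "finite X" "down_set X r Z"
  shows "down_closure X r (max_elems r Z) = Z"
proof
  show "down_closure X r (max_elems r Z) \<subseteq> Z"
    using assms(2) by (auto simp: down_closure_def down_set_def max_elems_def)
  have "Z \<subseteq> X" using assms(2) by (simp add: down_set_def)
  then show "Z \<subseteq> down_closure X r (max_elems r Z)"
    using ex_max_elem_above[OF poset _ \<open>Z \<subseteq> X\<close>] finite_subset[OF _ assms(1)]
    by (auto simp: down_closure_def)
qed

lemma max_elems_down_closure:
  assumes "antichain X r Y"
  shows "max_elems r (down_closure X r Y) = Y"
proof
  have Y: "Y \<subseteq> down_closure X r Y"
    using assms by (intro subset_down_closure) (simp add: antichain_def)
  show "max_elems r (down_closure X r Y) \<subseteq> Y"
  proof
    fix x assume x: "x \<in> max_elems r (down_closure X r Y)"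
    then obtain y where "y \<in> Y" "(x, y) \<in> r"
      by (auto simp: max_elems_def down_closure_def)
    with x Y show "x \<in> Y" by (auto simp: max_elems_def)
  qed
  show "Y \<subseteq> max_elems r (down_closure X r Y)"
  proof
    fix y assume y: "y \<in> Y"
    \<comment> \<open>Such an \<open>x\<close> lies between \<open>y\<close> and some
      \<open>z\<close> in \<open>Y\<close>; the antichain property gives \<open>z = y\<close>, and
      antisymmetry closes the gap.\<close>
    have "x = y" if x: "x \<in> down_closure X r Y" "(y, x) \<in> r" for x
    proof -
      obtain z where z: "z \<in> Y" "(x, z) \<in> r"
        using x(1) unfolding down_closure_def by blast
      then have "z = y"
        using assms y trans[OF x(2)] by (auto simp: antichain_def)
      then show ?thesis
        using z x(2) poset by (auto simp: partial_order_on_def dest: antisymD)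
    qed
    then show "y \<in> max_elems r (down_closure X r Y)"
      using y Y by (auto simp: max_elems_def)
  qed
qed

lemma h_plus_in_bases_plus:
  assumes "finite X" "A \<in> W_plus X r c"
  shows "h_plus X r c A \<in> bases_plus X r c"
proof -
  define P where "P = fiber X A Pos"
  define N where "N = fiber X A Neg"
  have P: "up_set X r P" and N: "down_set X r N" and cN: "c ` N \<subseteq> P"
    using assms(2) by (auto simp: W_plus_def P_def N_def)
  have sub: "P \<subseteq> X" "N \<subseteq> X" and NP: "N = X - P"
    by (simp_all add: P_def N_def fiber_subset fiber_Neg_eq)
  define Yp Ym where "Yp = min_elems r P - c ` max_elems r N" and "Ym = max_elems r N"
  have dN: "down_closure X r Ym = N"
    using down_closure_max_elems[OF assms(1) N] by (simp add: Ym_def)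
  have uP: "up_closure X r Yp \<union> up_closure X r (c ` Ym) = P"
  proof
    show "up_closure X r Yp \<union> up_closure X r (c ` Ym) \<subseteq> P"
      using P cN unfolding up_closure_def up_set_def Yp_def Ym_def min_elems_def max_elems_def
      by blast
    show "P \<subseteq> up_closure X r Yp \<union> up_closure X r (c ` Ym)"
    proof
      fix x assume x: "x \<in> P"
      obtain m where "m \<in> min_elems r P" "(m, x) \<in> r"
        using ex_min_elem_below[OF poset finite_subset[OF sub(1) assms(1)] sub(1) x] by blast
      \<comment> \<open>The minimal element \<open>m\<close> is in the \<open>c\<close>-image of
        \<open>Ym\<close> or else in \<open>Yp\<close>; either way one of the two up-closures
        contains \<open>x\<close>.\<close>
      then show "x \<in> up_closure X r Yp \<union> up_closure X r (c ` Ym)"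
        using x sub unfolding up_closure_def Yp_def Ym_def by blast
    qed
  qed
  have "antichain X r Yp" "antichain X r Ym" "Yp \<inter> Ym = {}"
    using sub NP by (auto simp: antichain_def Yp_def Ym_def min_elems_def max_elems_def)
  \<comment> \<open>An element of the \<open>c\<close>-image of \<open>Ym\<close> is in
    \<open>P\<close>, so below a minimal element of \<open>P\<close> it must equal it; but
    \<open>Yp\<close> omits that image.\<close>
  moreover have "down_closure X r Yp \<inter> c ` Ym = {}"
    using cN unfolding down_closure_def Yp_def Ym_def min_elems_def max_elems_def by blast
  moreover have "P \<inter> N = {}" "X = P \<union> N"
    using sub NP by auto
  ultimately have "(Yp, Ym) \<in> bases_plus X r c"
    unfolding bases_plus_def using uP dN by simp
  then show ?thesis
    by (simp add: h_plus_eq[OF assms(2)] Yp_def Ym_def P_def N_def)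
qed

text \<open>Equal second components have equal down-closures, so the \<open>Neg\<close> fibers
  agree. This fixes the values on \<open>X\<close>, and outside \<open>X\<close> both maps are
  \<open>undefined\<close>.\<close>

lemma inj_on_h_plus:
  assumes "finite X"
  shows "inj_on (h_plus X r c) (W_plus X r c)"
proof (rule inj_onI)
  fix A B assume A: "A \<in> W_plus X r c" and B: "B \<in> W_plus X r c"
    and eq: "h_plus X r c A = h_plus X r c B"
  have "down_closure X r (max_elems r (fiber X C Neg)) = fiber X C Neg" if "C \<in> W_plus X r c" for C
    using down_closure_max_elems[OF assms] that by (simp add: W_plus_def)
  then have "fiber X A Neg = fiber X B Neg"
    using eq A B h_plus_eq by (metis prod.inject)
  then have eq_Neg: "x \<in> fiber X A Neg \<longleftrightarrow> x \<in> fiber X B Neg" for x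
    by simp
  have "A x = B x" if "x \<in> X" for x
    using that eq_Neg[of x] by (cases "A x"; cases "B x") (simp_all add: fiber_def)
  then show "A = B"
    using A B by (auto simp: W_plus_def intro: PiE_ext)
qed

lemma h_plus_surj:
  assumes "(Yp, Ym) \<in> bases_plus X r c"
  shows "\<exists>A\<in>W_plus X r c. h_plus X r c A = (Yp, Ym)"
proof -
  define N where "N = down_closure X r Ym"
  define P where "P = up_closure X r Yp \<union> up_closure X r (c ` Ym)"
  have ac: "antichain X r Yp" "antichain X r Ym"
    and B1: "down_closure X r Yp \<inter> c ` Ym = {}"
    and B2: "P \<inter> N = {}" and B3: "X = P \<union> N"
    using assms by (auto simp: bases_plus_def N_def P_def)
  have Ym: "Ym \<subseteq> X" and Yp: "Yp \<subseteq> X" and cY: "c ` Ym \<subseteq> X"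
    using ac c_closed by (auto simp: antichain_def)
  \<comment> \<open>By (B2+) and (B3+), \<open>P\<close> is the complement of \<open>N\<close> in
    \<open>X\<close>, so it becomes the \<open>Pos\<close> fiber.\<close>
  define A where "A = (\<lambda>x\<in>X. if x \<in> N then Neg else Pos)"
  have fib: "fiber X A Neg = N" "fiber X A Pos = P"
    using B2 B3 by (auto simp: fiber_def A_def)
  have "up_set X r P" "down_set X r N"
    unfolding up_set_def down_set_def P_def N_def up_closure_def down_closure_def
    by (blast intro: trans)+
  \<comment> \<open>If \<open>x\<close> lies below \<open>z\<close> in \<open>Ym\<close>, then
    \<open>c x\<close> lies above \<open>c z\<close>, one of the generators of
    \<open>P\<close>.\<close>
  moreover have "c ` N \<subseteq> P"
    using c_antitone c_closed unfolding N_def P_def down_closure_def up_closure_def by blast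
  ultimately have A: "A \<in> W_plus X r c"
    using fib by (simp add: W_plus_def) (simp add: A_def)
  have max: "max_elems r N = Ym"
    unfolding N_def using max_elems_down_closure[OF ac(2)] .
  have "min_elems r P - c ` Ym = Yp"
  proof
    have gen: "Yp \<union> c ` Ym \<subseteq> P"
      using subset_up_closure[OF Yp] subset_up_closure[OF cY] unfolding P_def by blast
    show "min_elems r P - c ` Ym \<subseteq> Yp"
    proof
      fix x assume x: "x \<in> min_elems r P - c ` Ym"
      \<comment> \<open>A minimal element of \<open>P\<close> lies above some generator, which is
        itself in \<open>P\<close>, and so it is that generator.\<close>
      then obtain z where "z \<in> Yp \<union> c ` Ym" "(z, x) \<in> r"
        unfolding min_elems_def P_def up_closure_def by blast
      moreover from this have "z = x"
        using x gen unfolding min_elems_def by blast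
      ultimately show "x \<in> Yp" using x by blast
    qed
    show "Yp \<subseteq> min_elems r P - c ` Ym"
    proof
      fix y assume y: "y \<in> Yp"
      have "y \<in> down_closure X r Yp"
        using y subset_down_closure[OF Yp] by blast
      then have "y \<in> P" "y \<notin> c ` Ym"
        using y gen B1 by blast+
      \<comment> \<open>Some generator \<open>z\<close> lies below \<open>q\<close>, hence below
        \<open>y\<close>. For \<open>z\<close> in \<open>Yp\<close> the antichain property squeezes
        \<open>q\<close> onto \<open>y\<close>; for \<open>z\<close> in the \<open>c\<close>-image
        of \<open>Ym\<close> this contradicts (B1+).\<close>
      moreover have "q = y" if q: "q \<in> P" "(q, y) \<in> r" for q
      proof -
        consider z where "z \<in> Yp" "(z, q) \<in> r" | z where "z \<in> c ` Ym" "(z, q) \<in> r"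
          using q(1) unfolding P_def up_closure_def by blast
        then show ?thesis
        proof cases
          case 1
          then have "z = y" using ac(1) y trans[OF _ q(2)] by (auto simp: antichain_def)
          then show ?thesis
            using 1 q(2) poset by (auto simp: partial_order_on_def dest: antisymD)
        next
          case 2
          then show ?thesis
            using B1 y cY trans[OF _ q(2)] unfolding down_closure_def by blast
        qed
      qed
      ultimately show "y \<in> min_elems r P - c ` Ym"
        by (auto simp: min_elems_def)
    qed
  qed
  then have "h_plus X r c A = (Yp, Ym)"
    by (simp add: h_plus_eq[OF A] fib max)
  then show ?thesis using A by blast
qed

lemma bij_betw_h_plus:
  assumes "finite X"
  shows "bij_betw (h_plus X r c) (W_plus X r c) (bases_plus X r c)"
proof (rule bij_betw_imageI[OF inj_on_h_plus[OF assms]])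
  show "h_plus X r c ` W_plus X r c = bases_plus X r c"
  proof
    show "bases_plus X r c \<subseteq> h_plus X r c ` W_plus X r c"
      using h_plus_surj by (metis image_eqI subsetI surj_pair)
  qed (use h_plus_in_bases_plus[OF assms] in blast)
qed

end

section \<open>Passage to \<open>h_minus\<close> by order duality\<close>

definition opp :: "two \<Rightarrow> two" where
  "opp v = (if v = Pos then Neg else Pos)"

lemma opp_simps [simp]: "opp Pos = Neg" "opp Neg = Pos" "opp (opp v) = v"
  by (cases v; simp add: opp_def)+

lemma fiber_opp: "fiber X (\<lambda>x\<in>X. opp (A x)) v = fiber X A (opp v)"
  by (auto simp: fiber_def)

lemma W_minus_converse:
  "(\<lambda>x\<in>X. opp (A x)) \<in> W_plus X (r\<inverse>) c" if "A \<in> W_minus X r c"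
  using that
  by (auto simp: W_plus_def W_minus_def fiber_opp up_set_converse down_set_converse)

lemma W_plus_converse:
  "(\<lambda>x\<in>X. opp (A x)) \<in> W_minus X r c" if "A \<in> W_plus X (r\<inverse>) c"
  using that
  by (auto simp: W_plus_def W_minus_def fiber_opp up_set_converse down_set_converse)

text \<open>Reversing the order interchanges up-sets and down-sets; exchanging the two values
  restores their roles and turns one involution condition into the other.\<close>

lemma bij_betw_opp:
  "bij_betw (\<lambda>A. \<lambda>x\<in>X. opp (A x)) (W_minus X r c) (W_plus X (r\<inverse>) c)"
proof (rule bij_betw_byWitness[where f' = "\<lambda>A. \<lambda>x\<in>X. opp (A x)"])
  \<comment> \<open>The value swap is its own inverse; off \<open>X\<close> this relies on
    \<open>A\<close> being \<open>undefined\<close> there.\<close>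
  have inv: "(\<lambda>x\<in>X. opp ((\<lambda>x\<in>X. opp (A x)) x)) = A" if "A \<in> X \<rightarrow>\<^sub>E UNIV" for A
    using that by (auto simp: PiE_iff extensional_def)
  show "\<forall>A\<in>W_minus X r c. (\<lambda>x\<in>X. opp ((\<lambda>x\<in>X. opp (A x)) x)) = A"
    using inv unfolding W_minus_def by blast
  show "\<forall>A\<in>W_plus X (r\<inverse>) c. (\<lambda>x\<in>X. opp ((\<lambda>x\<in>X. opp (A x)) x)) = A"
    using inv unfolding W_plus_def by blast
qed (use W_minus_converse W_plus_converse in blast)+

lemma bases_plus_converse: "p \<in> bases_plus X (r\<inverse>) c \<longleftrightarrow> prod.swap p \<in> bases_minus X r c"
  by (cases p)
    (simp add: bases_plus_def bases_minus_def up_closure_converse down_closure_converse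
      antichain_converse Int_commute conj_ac)

lemma bij_betw_swap_bases:
  "bij_betw prod.swap (bases_plus X (r\<inverse>) c) (bases_minus X r c)"
  by (rule bij_betw_byWitness[where f' = prod.swap]) (auto simp: bases_plus_converse)

text \<open>After both reversals the maximal elements of the new \<open>Neg\<close> fiber are the
  minimal elements of the old \<open>Pos\<close> fiber, so the two cores coincide; only the order of
  the components differs.\<close>

lemma h_minus_eq_h_plus_converse:
  "h_minus X r c A = prod.swap (h_plus X (r\<inverse>) c (\<lambda>x\<in>X. opp (A x)))"
  by (simp add: h_minus_def h_plus_def core_minus_def core_plus_def N_set_def fiber_opp
      min_elems_converse max_elems_converse Un_commute)

lemma (in strong_involution_poset) bij_betw_h_minus:
  assumes "finite X"
  shows "bij_betw (h_minus X r c) (W_minus X r c) (bases_minus X r c)"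
proof -
  interpret dual: strong_involution_poset X "r\<inverse>" c by (rule dual)
  \<comment> \<open>Each of the three factors is a bijection between the relevant sets: value swap,
    \<open>h_plus\<close> of the dual poset, component swap.\<close>
  have "h_minus X r c = prod.swap \<circ> (h_plus X (r\<inverse>) c \<circ> (\<lambda>A. \<lambda>x\<in>X. opp (A x)))"
    by (simp add: fun_eq_iff h_minus_eq_h_plus_converse)
  then show ?thesis
    using bij_betw_trans[OF bij_betw_trans[OF bij_betw_opp dual.bij_betw_h_plus[OF assms]]
        bij_betw_swap_bases]
    by simp
qed

theorem theorem4p4:
  fixes X :: "'a set" and r :: "'a rel" and c :: "'a \<Rightarrow> 'a"
  assumes "strong_involution_poset X r c"
    and "finite X"
  shows "h_plus X r c \<in> W_plus X r c \<rightarrow> bases_plus X r c \<and>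
    h_minus X r c \<in> W_minus X r c \<rightarrow> bases_minus X r c \<and>
    bij_betw (h_plus X r c) (W_plus X r c) (bases_plus X r c) \<and>
    bij_betw (h_minus X r c) (W_minus X r c) (bases_minus X r c)"
  using strong_involution_poset.bij_betw_h_plus[OF assms]
    strong_involution_poset.bij_betw_h_minus[OF assms]
  by (auto dest: bij_betw_imp_funcset)

end
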